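(* For any $s_0\in\mathbb{N}$, there exists an ergodic transition matrix $P$ (over a finite space) such that $$\operatorname*{arg\,max}_{s\in\mathbb{N}}\left\{\frac{1-\kappa_s}{s}\right\}\subset[s_0,\infty).$$
   Context: $\mathbb{N}=\{1,2,\dots\}$. A row-stochastic matrix $P$ over a finite set $\mathcal{X}$ is ergodic if it is primitive ($P^q>0$ entrywise for some $q\in\mathbb{N}$). For $s\in\mathbb{N}$, $\kappa_s=\max_{\mu,\nu}\|\mu P^s-\nu P^s\|_{\mathsf{TV}}$, the maximum being over pairs of probability distributions (row vectors) on $\mathcal{X}$, where $\|\mu-\nu\|_{\mathsf{TV}}=\frac12\sum_x|\mu(x)-\nu(x)|$. The arg max denotes the set of all maximizers. *)

theory Defs
  imports Complex_Main "Jordan_Normal_Form.Matrix"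
begin

(* The state space of a chain with n states is {0..<n}; distributions on it are real vectors
   of dimension n and transition matrices are real n x n matrices. *)

definition prob_vecs :: "nat \<Rightarrow> real vec set" where
  "prob_vecs n = {\<mu> \<in> carrier_vec n. (\<forall>i<n. 0 \<le> \<mu> $ i) \<and> (\<Sum>i<n. \<mu> $ i) = 1}"

(* The state space must be nonempty: over an empty one every condition below holds vacuously. *)
definition row_stochastic :: "nat \<Rightarrow> real mat \<Rightarrow> bool" where
  "row_stochastic n P \<longleftrightarrow> 0 < n \<and> P \<in> carrier_mat n n \<and> (\<forall>i<n. row P i \<in> prob_vecs n)"

definition primitive :: "nat \<Rightarrow> real mat \<Rightarrow> bool" where
  "primitive n P \<longleftrightarrow> (\<exists>q::nat. 1 \<le> q \<and> (\<forall>i<n. \<forall>j<n. 0 < (P ^\<^sub>m q) $$ (i, j)))"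

definition ergodic :: "nat \<Rightarrow> real mat \<Rightarrow> bool" where
  "ergodic n P \<longleftrightarrow> row_stochastic n P \<and> primitive n P"

(* The library multiplies matrices only with column vectors, so the row vector \<mu> A is written
   as the transpose of A applied to \<mu>. *)
definition row_mult :: "real vec \<Rightarrow> real mat \<Rightarrow> real vec" where
  "row_mult \<mu> A = A\<^sup>T *\<^sub>v \<mu>"

definition tv_dist :: "real vec \<Rightarrow> real vec \<Rightarrow> real" where
  "tv_dist \<mu> \<nu> = 1 / 2 * (\<Sum>x<dim_vec \<mu>. \<bar>\<mu> $ x - \<nu> $ x\<bar>)"

(* The supremum is a maximum, by kappa_is_max below. *)
definition kappa :: "nat \<Rightarrow> real mat \<Rightarrow> nat \<Rightarrow> real" where
  "kappa n P s = (SUP (\<mu>, \<nu>) \<in> prob_vecs n \<times> prob_vecs n.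
     tv_dist (row_mult \<mu> (P ^\<^sub>m s)) (row_mult \<nu> (P ^\<^sub>m s)))"

definition argmax_on :: "'a set \<Rightarrow> ('a \<Rightarrow> real) \<Rightarrow> 'a set" where
  "argmax_on S f = {x. is_arg_max f (\<lambda>y. y \<in> S) x}"

lemma index_row_mult:
  assumes "A \<in> carrier_mat n n" "\<mu> \<in> carrier_vec n" "k < n"
  shows "row_mult \<mu> A $ k = (\<Sum>i<n. \<mu> $ i * A $$ (i, k))"
  using assms by (auto simp: row_mult_def scalar_prod_def atLeast0LessThan mult.commute)

lemma unit_vec_prob: "i < n \<Longrightarrow> unit_vec n i \<in> prob_vecs n"
  by (auto simp: prob_vecs_def unit_vec_def)

lemma tv_dist_row_mult_unit:
  assumes A: "A \<in> carrier_mat n n" and "i < n" "j < n"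
  shows "tv_dist (row_mult (unit_vec n i) A) (row_mult (unit_vec n j) A)
       = 1 / 2 * (\<Sum>k<n. \<bar>A $$ (i, k) - A $$ (j, k)\<bar>)"
proof -
  have u: "row_mult (unit_vec n i) A $ k = A $$ (i, k)" if "i < n" "k < n" for i k
  proof -
    have "row_mult (unit_vec n i) A $ k = (\<Sum>l<n. unit_vec n i $ l * A $$ (l, k))"
      by (rule index_row_mult[OF A _ that(2)]) simp
    also have "\<dots> = (\<Sum>l<n. if l = i then A $$ (l, k) else 0)"
      by (rule sum.cong) (use that in auto)
    finally show ?thesis using that by simp
  qed
  have d: "dim_vec (row_mult (unit_vec n i) A) = n" using A by (simp add: row_mult_def)
  show ?thesis unfolding tv_dist_def d using u assms by simp
qed

lemma tv_dist_row_mult_le: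
  assumes A: "A \<in> carrier_mat n n" and \<mu>: "\<mu> \<in> prob_vecs n" and \<nu>: "\<nu> \<in> prob_vecs n"
    and M: "\<And>i j. i < n \<Longrightarrow> j < n \<Longrightarrow> 1 / 2 * (\<Sum>k<n. \<bar>A $$ (i, k) - A $$ (j, k)\<bar>) \<le> M"
  shows "tv_dist (row_mult \<mu> A) (row_mult \<nu> A) \<le> M"
proof -
  have c: "\<mu> \<in> carrier_vec n" "\<nu> \<in> carrier_vec n"
    and s: "(\<Sum>i<n. \<mu> $ i) = 1" "(\<Sum>i<n. \<nu> $ i) = 1"
    and p: "\<And>i. i < n \<Longrightarrow> 0 \<le> \<mu> $ i" "\<And>i. i < n \<Longrightarrow> 0 \<le> \<nu> $ i"
    using \<mu> \<nu> by (auto simp: prob_vecs_def)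
  let ?w = "\<lambda>i j. \<mu> $ i * \<nu> $ j"
  have w0: "0 \<le> ?w i j" if "i < n" "j < n" for i j using p that by simp
  have w1: "(\<Sum>i<n. \<Sum>j<n. ?w i j) = 1"
    by (simp add: sum_distrib_left[symmetric] sum_distrib_right[symmetric] s)
  have diff: "\<bar>row_mult \<mu> A $ k - row_mult \<nu> A $ k\<bar>
      \<le> (\<Sum>i<n. \<Sum>j<n. ?w i j * \<bar>A $$ (i, k) - A $$ (j, k)\<bar>)" if k: "k < n" for k
  proof -
    have 1: "(\<Sum>i<n. \<Sum>j<n. ?w i j * A $$ (i, k)) = (\<Sum>i<n. \<mu> $ i * A $$ (i, k))"
    proof (rule sum.cong[OF refl])
      fix i
      have "(\<Sum>j<n. ?w i j * A $$ (i, k)) = (\<Sum>j<n. \<nu> $ j) * (\<mu> $ i * A $$ (i, k))"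
        unfolding sum_distrib_right by (rule sum.cong) auto
      then show "(\<Sum>j<n. ?w i j * A $$ (i, k)) = \<mu> $ i * A $$ (i, k)" by (simp add: s)
    qed
    have 2: "(\<Sum>i<n. \<Sum>j<n. ?w i j * A $$ (j, k)) = (\<Sum>j<n. \<nu> $ j * A $$ (j, k))"
    proof -
      have "(\<Sum>i<n. \<Sum>j<n. ?w i j * A $$ (j, k))
          = (\<Sum>i<n. \<mu> $ i * (\<Sum>j<n. \<nu> $ j * A $$ (j, k)))"
        by (simp add: sum_distrib_left mult.assoc)
      then show ?thesis by (simp add: sum_distrib_right[symmetric] s)
    qed
    have "row_mult \<mu> A $ k - row_mult \<nu> A $ k
        = (\<Sum>i<n. \<Sum>j<n. ?w i j * (A $$ (i, k) - A $$ (j, k)))"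
      by (simp add: index_row_mult[OF A _ k] c 1 2 right_diff_distrib sum_subtractf)
    also have "\<bar>\<dots>\<bar> \<le> (\<Sum>i<n. \<Sum>j<n. \<bar>?w i j * (A $$ (i, k) - A $$ (j, k))\<bar>)"
      by (rule order_trans[OF sum_abs]) (rule sum_mono, rule sum_abs)
    also have "\<dots> = (\<Sum>i<n. \<Sum>j<n. ?w i j * \<bar>A $$ (i, k) - A $$ (j, k)\<bar>)"
      by (intro sum.cong refl) (use p in \<open>auto simp: abs_mult\<close>)
    finally show ?thesis .
  qed
  have d: "dim_vec (row_mult \<mu> A) = n" using A by (simp add: row_mult_def)
  have "tv_dist (row_mult \<mu> A) (row_mult \<nu> A)
      \<le> 1 / 2 * (\<Sum>k<n. \<Sum>i<n. \<Sum>j<n. ?w i j * \<bar>A $$ (i, k) - A $$ (j, k)\<bar>)"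
    unfolding tv_dist_def d by (intro mult_left_mono sum_mono diff) auto
  also have "(\<Sum>k<n. \<Sum>i<n. \<Sum>j<n. ?w i j * \<bar>A $$ (i, k) - A $$ (j, k)\<bar>)
      = (\<Sum>i<n. \<Sum>k<n. \<Sum>j<n. ?w i j * \<bar>A $$ (i, k) - A $$ (j, k)\<bar>)"
    by (rule sum.swap)
  also have "\<dots> = (\<Sum>i<n. \<Sum>j<n. \<Sum>k<n. ?w i j * \<bar>A $$ (i, k) - A $$ (j, k)\<bar>)"
    by (rule sum.cong[OF refl]) (rule sum.swap)
  also have "1 / 2 * \<dots> = (\<Sum>i<n. \<Sum>j<n. ?w i j * (1 / 2 * (\<Sum>k<n. \<bar>A $$ (i, k) - A $$ (j, k)\<bar>)))"
    by (simp add: sum_distrib_left)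
  also have "\<dots> \<le> (\<Sum>i<n. \<Sum>j<n. ?w i j * M)"
    by (intro sum_mono mult_left_mono M w0) auto
  also have "\<dots> = M"
    by (simp add: sum_distrib_right[symmetric] w1)
  finally show ?thesis .
qed

lemma kappa_is_max:
  assumes "P \<in> carrier_mat n n" "0 < n"
  shows "\<exists>\<mu>\<in>prob_vecs n. \<exists>\<nu>\<in>prob_vecs n.
           kappa n P s = tv_dist (row_mult \<mu> (P ^\<^sub>m s)) (row_mult \<nu> (P ^\<^sub>m s))"
    and "\<mu> \<in> prob_vecs n \<Longrightarrow> \<nu> \<in> prob_vecs n \<Longrightarrow>
           tv_dist (row_mult \<mu> (P ^\<^sub>m s)) (row_mult \<nu> (P ^\<^sub>m s)) \<le> kappa n P s"
proof -
  define A where "A = P ^\<^sub>m s"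
  have A: "A \<in> carrier_mat n n" using assms by (simp add: A_def)
  let ?r = "\<lambda>(i, j). 1 / 2 * (\<Sum>k<n. \<bar>A $$ (i, k) - A $$ (j, k)\<bar>)"
  let ?R = "?r ` ({..<n} \<times> {..<n})"
  have fin: "finite ?R" by simp
  have "Max ?R \<in> ?R" using assms by (intro Max_in) auto
  then obtain i j where ij: "i < n" "j < n" and e: "Max ?R = ?r (i, j)" by blast
  have le: "tv_dist (row_mult \<mu> A) (row_mult \<nu> A) \<le> Max ?R"
    if "\<mu> \<in> prob_vecs n" "\<nu> \<in> prob_vecs n" for \<mu> \<nu>
  proof (rule tv_dist_row_mult_le[OF A that])
    fix i j assume "i < n" "j < n"
    then have "?r (i, j) \<in> ?R" by (intro imageI) auto
    from Max_ge[OF fin this]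
    show "1 / 2 * (\<Sum>k<n. \<bar>A $$ (i, k) - A $$ (j, k)\<bar>) \<le> Max ?R" by simp
  qed
  have at: "tv_dist (row_mult (unit_vec n i) A) (row_mult (unit_vec n j) A) = Max ?R"
    unfolding e using tv_dist_row_mult_unit[OF A ij] by simp
  have k: "kappa n P s = Max ?R"
    unfolding kappa_def A_def[symmetric]
  proof (rule cSup_eq_maximum)
    show "Max ?R \<in> (\<lambda>(\<mu>, \<nu>). tv_dist (row_mult \<mu> A) (row_mult \<nu> A)) ` (prob_vecs n \<times> prob_vecs n)"
      by (rule image_eqI[of _ _ "(unit_vec n i, unit_vec n j)"]) (use at ij unit_vec_prob in auto)
  next
    fix x assume "x \<in> (\<lambda>(\<mu>, \<nu>). tv_dist (row_mult \<mu> A) (row_mult \<nu> A)) ` (prob_vecs n \<times> prob_vecs n)"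
    then show "x \<le> Max ?R" using le by auto
  qed
  show "\<exists>\<mu>\<in>prob_vecs n. \<exists>\<nu>\<in>prob_vecs n.
           kappa n P s = tv_dist (row_mult \<mu> (P ^\<^sub>m s)) (row_mult \<nu> (P ^\<^sub>m s))"
    using k at ij unit_vec_prob unfolding A_def[symmetric] by metis
  show "\<mu> \<in> prob_vecs n \<Longrightarrow> \<nu> \<in> prob_vecs n \<Longrightarrow>
           tv_dist (row_mult \<mu> (P ^\<^sub>m s)) (row_mult \<nu> (P ^\<^sub>m s)) \<le> kappa n P s"
    using k le unfolding A_def[symmetric] by simp
qed

end

theory Submission
  imports Defs
begin

text \<open>
  The states form a path \<open>0 \<rightarrow> 1 \<rightarrow> \<dots> \<rightarrow> s\<^sub>0\<close> that is walked deterministically, and from the last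
  state the chain restarts uniformly. Before time \<open>s\<^sub>0\<close> the walks from \<open>0\<close> and \<open>1\<close> are at distinct
  points, so \<open>\<kappa>\<^sub>s = 1\<close> and the objective vanishes there; every power from \<open>s\<^sub>0 + 1\<close> on is positive,
  so the objective is positive somewhere.
\<close>

text \<open>For positive reals \<bar>a - b\<bar> < a + b, and the right-hand sides add up to 2 over
  all states.\<close>

lemma tv_dist_less_one:
  assumes \<mu>: "\<mu> \<in> prob_vecs n" and \<nu>: "\<nu> \<in> prob_vecs n" and n: "0 < n"
    and pos: "\<And>k. k < n \<Longrightarrow> 0 < \<mu> $ k" "\<And>k. k < n \<Longrightarrow> 0 < \<nu> $ k"
  shows "tv_dist \<mu> \<nu> < 1"
proof -
  have "(\<Sum>k<n. \<bar>\<mu> $ k - \<nu> $ k\<bar>) < (\<Sum>k<n. \<mu> $ k + \<nu> $ k)"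
  proof (rule sum_strict_mono)
    show "\<bar>\<mu> $ k - \<nu> $ k\<bar> < \<mu> $ k + \<nu> $ k" if "k \<in> {..<n}" for k
      using pos[of k] that by simp
  qed (use n in auto)
  also have "\<dots> = 2"
    using \<mu> \<nu> by (simp add: prob_vecs_def sum.distrib)
  finally show ?thesis
    using \<mu> by (auto simp: tv_dist_def prob_vecs_def)
qed

lemma row_mult_prob_vecs:
  assumes A: "row_stochastic n A" and \<mu>: "\<mu> \<in> prob_vecs n"
  shows "row_mult \<mu> A \<in> prob_vecs n"
proof -
  have cA: "A \<in> carrier_mat n n" and c\<mu>: "\<mu> \<in> carrier_vec n"
    and s\<mu>: "(\<Sum>i<n. \<mu> $ i) = 1" and p\<mu>: "\<And>i. i < n \<Longrightarrow> 0 \<le> \<mu> $ i"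
    using A \<mu> by (auto simp: row_stochastic_def prob_vecs_def)
  have pA: "0 \<le> A $$ (i, k)" if "i < n" "k < n" for i k
    using A that by (auto simp: row_stochastic_def prob_vecs_def)
  have sA: "(\<Sum>k<n. A $$ (i, k)) = 1" if "i < n" for i
    using A that by (auto simp: row_stochastic_def prob_vecs_def)
  have "(\<Sum>k<n. \<Sum>i<n. \<mu> $ i * A $$ (i, k)) = (\<Sum>i<n. \<Sum>k<n. \<mu> $ i * A $$ (i, k))"
    by (rule sum.swap)
  also have "\<dots> = 1"
    by (simp add: sum_distrib_left[symmetric] sA s\<mu>)
  finally have "(\<Sum>k<n. row_mult \<mu> A $ k) = 1"
    by (simp add: index_row_mult[OF cA c\<mu>])
  moreover have "0 \<le> row_mult \<mu> A $ k" if "k < n" for k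
    using that by (auto simp: index_row_mult[OF cA c\<mu>] intro!: sum_nonneg mult_nonneg_nonneg p\<mu> pA)
  moreover have "row_mult \<mu> A \<in> carrier_vec n"
    using cA c\<mu> by (simp add: row_mult_def)
  ultimately show ?thesis
    by (simp add: prob_vecs_def)
qed

text \<open>Row \<open>i\<close> of \<open>A * B\<close> is the image of row \<open>i\<close> of
  \<open>A\<close> under \<open>B\<close>, so \<open>row_mult_prob_vecs\<close> applies row by
  row.\<close>

lemma row_stochastic_mult:
  assumes A: "row_stochastic n A" and B: "row_stochastic n B"
  shows "row_stochastic n (A * B)"
proof -
  have c: "A \<in> carrier_mat n n" "B \<in> carrier_mat n n" and n: "0 < n"
    using A B by (auto simp: row_stochastic_def)
  have "row (A * B) i = row_mult (row A i) B" if "i < n" for i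
    using c that by (intro eq_vecI) (auto simp: row_mult_def comm_scalar_prod[of _ n])
  then show ?thesis
    using A c n row_mult_prob_vecs[OF B] by (auto simp: row_stochastic_def)
qed

lemma row_stochastic_pow:
  assumes "row_stochastic n P"
  shows "row_stochastic n (P ^\<^sub>m s)"
proof (induction s)
  case 0
  have "0 < n" "P \<in> carrier_mat n n"
    using assms by (auto simp: row_stochastic_def)
  then show ?case
    by (auto simp: row_stochastic_def unit_vec_prob)
next
  case (Suc s)
  then show ?case
    using row_stochastic_mult[OF _ assms] by simp
qed

text \<open>Every distribution gives positive mass to some state, so a positive matrix sends it to a
  distribution with full support. Two such images overlap, which keeps their distance below
  1.\<close>

lemma kappa_less_one:
  assumes P: "row_stochastic n P"
    and pos: "\<And>i k. i < n \<Longrightarrow> k < n \<Longrightarrow> 0 < (P ^\<^sub>m s) $$ (i, k)"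
  shows "kappa n P s < 1"
proof -
  have c: "P \<in> carrier_mat n n" and n: "0 < n"
    using P by (auto simp: row_stochastic_def)
  have cs: "P ^\<^sub>m s \<in> carrier_mat n n"
    using c by simp
  have pv: "0 < row_mult \<mu> (P ^\<^sub>m s) $ k" if \<mu>: "\<mu> \<in> prob_vecs n" and k: "k < n" for \<mu> k
  proof -
    have c\<mu>: "\<mu> \<in> carrier_vec n" and s\<mu>: "(\<Sum>i<n. \<mu> $ i) = 1" and p\<mu>: "\<forall>i<n. 0 \<le> \<mu> $ i"
      using \<mu> by (auto simp: prob_vecs_def)
    have "\<exists>i<n. \<mu> $ i \<noteq> 0"
      using s\<mu> by (metis (no_types, lifting) lessThan_iff sum.neutral zero_neq_one)
    then obtain i where i: "i < n" "0 < \<mu> $ i"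
      using p\<mu> by (auto simp: less_le)
    have "0 < (\<Sum>i<n. \<mu> $ i * (P ^\<^sub>m s) $$ (i, k))"
      by (rule sum_pos2[of _ i]) (use i p\<mu> pos k in \<open>auto simp: less_imp_le\<close>)
    then show ?thesis
      by (simp add: index_row_mult[OF cs c\<mu> k])
  qed
  \<comment> \<open>Strictness for each single pair passes to the supremum because the supremum is
    attained.\<close>
  obtain \<mu> \<nu> where "\<mu> \<in> prob_vecs n" "\<nu> \<in> prob_vecs n"
    and "kappa n P s = tv_dist (row_mult \<mu> (P ^\<^sub>m s)) (row_mult \<nu> (P ^\<^sub>m s))"
    using kappa_is_max(1)[OF c n] by blast
  then show ?thesis
    using tv_dist_less_one[OF _ _ n pv pv] row_mult_prob_vecs[OF row_stochastic_pow[OF P]] by simp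
qed

text \<open>With the extra factor on the left, an induction on the exponent splits off the first
  step of the chain instead of the last.\<close>

lemma pow_mat_Suc_left:
  fixes A :: "'a :: semiring_1 mat"
  assumes A: "A \<in> carrier_mat n n"
  shows "A ^\<^sub>m Suc k = A * A ^\<^sub>m k"
proof (induction k)
  case 0
  then show ?case
    using A by simp
next
  case (Suc k)
  have "A ^\<^sub>m Suc (Suc k) = (A * A ^\<^sub>m k) * A"
    using Suc by simp
  also have "\<dots> = A * A ^\<^sub>m Suc k"
    using assoc_mult_mat[OF A pow_carrier_mat[OF A] A] by simp
  finally show ?case .
qed

text \<open>The restart is uniform because a jump from the last state back to 0 would give a cyclic
  permutation, which for \<open>n > 1\<close> has no positive power.\<close>

definition restart_path :: "nat \<Rightarrow> real mat" where
  "restart_path n = mat n n (\<lambda>(i, j).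
     if Suc i = n then 1 / real n else if j = Suc i then 1 else 0)"

lemma restart_path_carrier [simp]: "restart_path n \<in> carrier_mat n n"
  and restart_path_dim [simp]: "dim_row (restart_path n) = n" "dim_col (restart_path n) = n"
  by (simp_all add: restart_path_def)

lemma restart_path_row_stochastic:
  assumes "0 < n"
  shows "row_stochastic n (restart_path n)"
proof -
  have "(\<Sum>j<n. restart_path n $$ (i, j)) = 1" if "i < n" for i
  proof (cases "Suc i = n")
    case True
    then show ?thesis
      by (simp add: restart_path_def)
  next
    case False
    then show ?thesis
      using that by (simp add: restart_path_def)
  qed
  then show ?thesis
    using assms by (auto simp: row_stochastic_def prob_vecs_def restart_path_def)
qed

text \<open>First-step analysis: the walk from \<open>i\<close> moves to \<open>Suc i\<close>, or
  averages over all starting points if \<open>i\<close> is the last state.\<close>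

lemma restart_path_pow_Suc:
  assumes ij: "i < n" "j < n"
  shows "(restart_path n ^\<^sub>m Suc s) $$ (i, j)
       = (if Suc i = n then (\<Sum>k<n. (restart_path n ^\<^sub>m s) $$ (k, j)) / real n
          else (restart_path n ^\<^sub>m s) $$ (Suc i, j))"
proof -
  let ?Q = "restart_path n ^\<^sub>m s"
  have c: "?Q \<in> carrier_mat n n"
    by simp
  have "restart_path n ^\<^sub>m Suc s = restart_path n * ?Q"
    by (rule pow_mat_Suc_left[OF restart_path_carrier])
  also have "\<dots> $$ (i, j) = (\<Sum>k<n. restart_path n $$ (i, k) * ?Q $$ (k, j))"
    using ij c by (auto simp: restart_path_def scalar_prod_def atLeast0LessThan)
  also have "\<dots> = (if Suc i = n then (\<Sum>k<n. ?Q $$ (k, j)) / real n else ?Q $$ (Suc i, j))"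
  proof (cases "Suc i = n")
    case True
    then show ?thesis
      using ij by (simp add: restart_path_def sum_divide_distrib)
  next
    case False
    have "(\<Sum>k<n. restart_path n $$ (i, k) * ?Q $$ (k, j))
        = (\<Sum>k<n. if k = Suc i then ?Q $$ (k, j) else 0)"
      by (rule sum.cong) (use False ij in \<open>auto simp: restart_path_def\<close>)
    then show ?thesis
      using False ij by simp
  qed
  finally show ?thesis .
qed

text \<open>As long as \<open>i + s < n\<close>, the walk has not yet left the last state, so only
  the deterministic case of the first-step recursion occurs.\<close>

lemma restart_path_pow_deterministic:
  "i + s < n \<Longrightarrow> j < n \<Longrightarrow> (restart_path n ^\<^sub>m s) $$ (i, j) = (if j = i + s then 1 else 0)"
proof (induction s arbitrary: i)
  case 0
  then show ?case
    by (simp add: restart_path_def)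
next
  case (Suc s)
  then show ?case
    using restart_path_pow_Suc[of i n j s] by simp
qed

text \<open>The walk from \<open>i\<close> makes its first restart at time \<open>n - i\<close>, so
  \<open>n \<le> i + s\<close> says that it has restarted by time \<open>s\<close>. A step along the
  path preserves the sum \<open>i + s\<close>, hence the hypothesis.\<close>

lemma restart_path_pow_pos:
  "i < n \<Longrightarrow> j < n \<Longrightarrow> n \<le> i + s \<Longrightarrow> 0 < (restart_path n ^\<^sub>m s) $$ (i, j)"
proof (induction s arbitrary: i)
  case 0
  then show ?case by simp
next
  case (Suc s)
  let ?Q = "restart_path n ^\<^sub>m s"
  show ?case
  proof (cases "Suc i = n")
    case False
    then show ?thesis
      using Suc restart_path_pow_Suc[of i n j s] by simp
  next
    case True
    have "row_stochastic n ?Q"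
      using Suc.prems by (intro row_stochastic_pow restart_path_row_stochastic) simp
    then have nonneg: "0 \<le> ?Q $$ (k, j)" if "k < n" for k
      using that Suc.prems by (auto simp: row_stochastic_def prob_vecs_def)
    \<comment> \<open>At the last state the new entry is the average of column \<open>j\<close>, so
      one positive entry suffices. For \<open>s = 0\<close> it is the diagonal one; otherwise the
      last state \<open>i\<close> itself works, since \<open>i + s = n - 1 + s\<close> is at least
      \<open>n\<close>.\<close>
    have "\<exists>k<n. 0 < ?Q $$ (k, j)"
    proof (cases "s = 0")
      case True
      then show ?thesis
        using Suc.prems by (auto simp: restart_path_def intro!: exI[of _ j])
    next
      case False
      then show ?thesis
        using Suc True by (intro exI[of _ i]) auto
    qed
    then obtain k where "k < n" "0 < ?Q $$ (k, j)" by blast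
    then have "0 < (\<Sum>k<n. ?Q $$ (k, j))"
      using nonneg by (intro sum_pos2[of _ k]) auto
    then show ?thesis
      using True Suc.prems restart_path_pow_Suc[of i n j s] by simp
  qed
qed

text \<open>The exponent \<open>n\<close> serves all starting points at once: even the walk from 0
  has restarted by then.\<close>

lemma restart_path_ergodic:
  assumes "0 < n"
  shows "ergodic n (restart_path n)"
  unfolding ergodic_def primitive_def
  using assms restart_path_row_stochastic restart_path_pow_pos[of _ n _ n]
  by (auto intro!: exI[of _ n])

text \<open>Rows 0 and 1 of the power are point masses at \<open>s\<close> and \<open>Suc s\<close>.
  The hypothesis ensures that the walk from 1, the one further ahead, has not restarted.\<close>

lemma restart_path_kappa_ge_one:
  assumes s: "Suc s < n"
  shows "1 \<le> kappa n (restart_path n) s"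
proof -
  let ?Q = "restart_path n ^\<^sub>m s"
  have c: "?Q \<in> carrier_mat n n" by simp
  have "(\<Sum>k<n. \<bar>?Q $$ (0, k) - ?Q $$ (1, k)\<bar>)
      = (\<Sum>k<n. (if k = s then 1 else 0) + (if k = Suc s then 1 else 0))"
    by (rule sum.cong) (use s in \<open>auto simp: restart_path_pow_deterministic\<close>)
  also have "\<dots> = 2"
    using s by (simp add: sum.distrib)
  finally have "tv_dist (row_mult (unit_vec n 0) ?Q) (row_mult (unit_vec n 1) ?Q) = 1"
    using s by (subst tv_dist_row_mult_unit[OF c]) auto
  then show ?thesis
    using s kappa_is_max(2)[of "restart_path n" n "unit_vec n 0" "unit_vec n 1" s]
    by (simp add: unit_vec_prob)
qed

theorem theorem2p3:
  fixes s0 :: nat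
  assumes "1 \<le> s0"
  shows "\<exists>(n::nat) (P :: real mat). ergodic n P \<and>
           argmax_on {s::nat. 1 \<le> s} (\<lambda>s. (1 - kappa n P s) / real s) \<subseteq> {s0..}"
proof -
  \<comment> \<open>With \<open>s0 + 1\<close> states, the times with \<open>Suc s < ?n\<close> are
    exactly those below \<open>s0\<close>.\<close>
  let ?n = "Suc s0" let ?P = "restart_path (Suc s0)"
  let ?f = "\<lambda>s. (1 - kappa ?n ?P s) / real s"
  have "kappa ?n ?P ?n < 1"
    by (intro kappa_less_one restart_path_row_stochastic restart_path_pow_pos) auto
  then have pos: "0 < ?f ?n" by simp
  have "s0 \<le> s" if s: "is_arg_max ?f (\<lambda>s. s \<in> {s. 1 \<le> s}) s" for s
  proof (rule ccontr)
    assume "\<not> s0 \<le> s"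
    then have "1 \<le> kappa ?n ?P s"
      by (intro restart_path_kappa_ge_one) simp
    then have "?f s \<le> 0"
      by (simp add: divide_nonpos_nonneg)
    then have "?f s < ?f ?n"
      using pos by linarith
    \<comment> \<open>A maximizer is not beaten by the admissible time \<open>?n\<close>.\<close>
    moreover have "\<not> ?f s < ?f ?n"
      using s by (auto simp: is_arg_max_def simp del: of_nat_Suc)
    ultimately show False by contradiction
  qed
  then have "argmax_on {s::nat. 1 \<le> s} ?f \<subseteq> {s0..}"
    by (auto simp: argmax_on_def)
  then show ?thesis
    using restart_path_ergodic[of ?n] by blast
qed

end
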